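(* Let $p>1$ and let $\{(x_i,y_i)\}_{i=1}^n\subset\mathbb{R}^d\times\{\pm1\}$ be linearly separable, i.e. there is $w^*\in\mathbb{R}^d$ with $\mathrm{sign}(\langle w^*,x_i\rangle)=y_i$ for all $i$, and assume there is a constant $C$ with $\max_i\|x_i\|_q<C$, where $1/p+1/q=1$. Let $L(w)=\frac1n\sum_{i=1}^n\ell(y_i\langle w,x_i\rangle)$, where $\ell:\mathbb{R}\to\mathbb{R}$ is differentiable, decreasing, convex, does not attain its minimum, and $\inf\ell=0$. Suppose the regularized direction $\bar w^{\mathrm{reg}}_p$ with respect to the $\ell_p$-norm exists. Then for sufficiently small step size $\eta>0$, the iterates $w_t$ of $p$-GD satisfy $$\lim_{t\to\infty}\frac{w_t}{\|w_t\|_p}=\bar w^{\mathrm{reg}}_p.$$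
   Context: $p$-GD is mirror descent with potential $\psi(w)=\frac1p\|w\|_p^p$, i.e. from an initialization $w_0\in\mathbb{R}^d$, the update $\nabla\psi(w_{t+1})=\nabla\psi(w_t)-\eta\nabla L(w_t)$, which coordinatewise reads: $w_t^+[j]=|w_t[j]|^{p-1}\mathrm{sign}(w_t[j])-\eta\nabla L(w_t)[j]$ and $w_{t+1}[j]=|w_t^+[j]|^{1/(p-1)}\mathrm{sign}(w_t^+[j])$. The regularization path is $\bar w_p(B)=\arg\min_{\|w\|_p\le B}L(w)$ for $B>0$; if the limit $\lim_{B\to\infty}\bar w_p(B)/B$ exists, it is called the regularized direction and denoted $\bar w^{\mathrm{reg}}_p$. *)

theory Defs
  imports "HOL-Analysis.Analysis"
begin

definition pnorm :: "real \<Rightarrow> real ^ 'd \<Rightarrow> real" where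
  "pnorm p v = (\<Sum>j\<in>UNIV. \<bar>v $ j\<bar> powr p) powr (1 / p)"

definition grad :: "(real ^ 'd \<Rightarrow> real) \<Rightarrow> real ^ 'd \<Rightarrow> real ^ 'd" where
  "grad f w = (THE g. (f has_derivative (\<lambda>h. g \<bullet> h)) (at w))"

definition emp_risk :: "(real \<Rightarrow> real) \<Rightarrow> nat \<Rightarrow> (nat \<Rightarrow> real ^ 'd) \<Rightarrow> (nat \<Rightarrow> real)
    \<Rightarrow> real ^ 'd \<Rightarrow> real" where
  "emp_risk l n x y w = (1 / real n) * (\<Sum>i<n. l (y i * (w \<bullet> x i)))"

text \<open>p-GD: mirror descent with potential psi(w) = (1/p) ||w||_p^p, coordinatewise.\<close>
definition pgd_step :: "real \<Rightarrow> real \<Rightarrow> (real ^ 'd \<Rightarrow> real) \<Rightarrow> real ^ 'd \<Rightarrow> real ^ 'd" where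
  "pgd_step p \<eta> L w =
     (let wp = (\<chi> j. \<bar>w $ j\<bar> powr (p - 1) * sgn (w $ j) - \<eta> * (grad L w) $ j)
      in \<chi> j. \<bar>wp $ j\<bar> powr (1 / (p - 1)) * sgn (wp $ j))"

primrec pgd :: "real \<Rightarrow> real \<Rightarrow> (real ^ 'd \<Rightarrow> real) \<Rightarrow> real ^ 'd \<Rightarrow> nat \<Rightarrow> real ^ 'd" where
  "pgd p \<eta> L w0 0 = w0"
| "pgd p \<eta> L w0 (Suc t) = pgd_step p \<eta> L (pgd p \<eta> L w0 t)"

text \<open>wb is a regularization path: wb B \<in> argmin_{||w||_p \<le> B} L(w) for every B > 0
  (argmin need not be unique, so we speak of any selection).\<close>
definition is_reg_path :: "real \<Rightarrow> (real ^ 'd \<Rightarrow> real) \<Rightarrow> (real \<Rightarrow> real ^ 'd) \<Rightarrow> bool" where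
  "is_reg_path p L wb \<longleftrightarrow>
     (\<forall>B>0. pnorm p (wb B) \<le> B \<and> (\<forall>v. pnorm p v \<le> B \<longrightarrow> L (wb B) \<le> L v))"

definition reg_direction :: "real \<Rightarrow> (real ^ 'd \<Rightarrow> real) \<Rightarrow> real ^ 'd \<Rightarrow> bool" where
  "reg_direction p L r \<longleftrightarrow>
     (\<forall>wb. is_reg_path p L wb \<longrightarrow> ((\<lambda>B. (1 / B) *\<^sub>R wb B) \<longlongrightarrow> r) at_top)"

end

theory Submission
  imports Defs
begin

text \<open>
  Write the iteration in the dual variable \<open>z = \<nabla>\<psi>(w)\<close>, so that \<open>z\<close> moves by \<open>- \<eta> \<nabla>L(w)\<close> and
  \<open>w / \<parallel>w\<parallel>\<^sub>p\<close> is the gradient of the dual norm \<open>N = \<parallel>\<cdot>\<parallel>\<^sub>q\<close> at \<open>z\<close>. Since the regularization path points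
  to \<open>r\<close>, for large \<open>w\<close> the loss at \<open>(1 + \<alpha>) \<parallel>w\<parallel>\<^sub>p r\<close> is below the loss at \<open>w\<close>, so by convexity
  \<open>\<langle>-\<nabla>L(w), w / \<parallel>w\<parallel>\<^sub>p\<rangle> \<le> (1 + \<alpha>) \<langle>-\<nabla>L(w), r\<rangle>\<close>: up to the factor \<open>1 + \<delta>\<close>, the norm \<open>N z\<close> grows no faster
  than \<open>\<langle>z, r\<rangle>\<close>. Since \<open>\<langle>z, r\<rangle>\<close> tends to infinity, \<open>\<langle>z, r\<rangle> / N z\<close> tends to \<open>1\<close>, and the equality case of
  Hoelder's inequality gives \<open>w / \<parallel>w\<parallel>\<^sub>p \<longlongrightarrow> r\<close>.
\<close>

section \<open>Conjugate exponents\<close>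

definition spow :: "real \<Rightarrow> real \<Rightarrow> real" where
  "spow s t = \<bar>t\<bar> powr s * sgn t"

lemma continuous_on_spow:
  assumes "s > 0" and "continuous_on A f"
  shows "continuous_on A (\<lambda>x. spow s (f x))"
proof -
  \<comment> \<open>Splitting into positive and negative parts avoids the jump of \<open>sgn\<close>
    at zero.\<close>
  have "spow s t = (max t 0) powr s - (max (- t) 0) powr s" for t
    using assms by (cases "t > 0"; cases "t = 0") (auto simp: spow_def max_def)
  moreover have "continuous_on A (\<lambda>x. (max (f x) 0) powr s - (max (- f x) 0) powr s)"
    using assms by (intro continuous_intros continuous_on_powr') auto
  ultimately show ?thesis by simp
qed

lemma abs_spow: "\<bar>spow s t\<bar> = \<bar>t\<bar> powr s"
  by (auto simp: spow_def abs_mult abs_sgn_eq)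

lemma sgn_spow: "sgn (spow s t) = sgn t"
  by (cases "t = 0") (auto simp: spow_def sgn_mult)

lemma spow_spow:
  assumes "s * u = 1"
  shows "spow u (spow s t) = t"
proof -
  have "\<bar>t\<bar> powr (s * u) * sgn t = t"
    using assms by (auto simp: sgn_if)
  then show ?thesis
    unfolding spow_def [of u] by (simp add: abs_spow sgn_spow powr_powr)
qed

text \<open>With \<open>s = p - 1\<close> this is the mirror map \<nabla>\<psi>; with
  \<open>s = q - 1\<close> it is the inverse map, back from dual to primal variables.\<close>

definition spow_vec :: "real \<Rightarrow> real ^ 'd \<Rightarrow> real ^ 'd" where
  "spow_vec s v = (\<chi> j. spow s (v $ j))"

lemma spow_vec_spow_vec: "s * u = 1 \<Longrightarrow> spow_vec u (spow_vec s v) = v"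
  by (simp add: spow_vec_def spow_spow vec_eq_iff)

lemma continuous_on_spow_vec: "s > 0 \<Longrightarrow> continuous_on A (spow_vec s)"
  unfolding spow_vec_def
  by (intro continuous_on_vec_lambda continuous_on_spow continuous_intros)

section \<open>Homogeneity, norm comparison and compact shells for \<open>pnorm\<close>\<close>

lemma pnorm_nonneg: "pnorm p v \<ge> 0"
  by (simp add: pnorm_def)

lemma pnorm_powr: "p > 0 \<Longrightarrow> pnorm p v powr p = (\<Sum>j\<in>UNIV. \<bar>v $ j\<bar> powr p)"
  by (simp add: pnorm_def powr_powr sum_nonneg)

lemma continuous_on_pnorm: "p > 0 \<Longrightarrow> continuous_on A (pnorm p)"
  unfolding pnorm_def
  by (intro continuous_on_powr' continuous_intros) (auto simp: sum_nonneg)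

lemma pnorm_scaleR:
  assumes "p > 0"
  shows "pnorm p (c *\<^sub>R v) = \<bar>c\<bar> * pnorm p v"
proof -
  have "pnorm p (c *\<^sub>R v) = (\<bar>c\<bar> powr p * (\<Sum>j\<in>UNIV. \<bar>v $ j\<bar> powr p)) powr (1 / p)"
    by (simp add: pnorm_def abs_mult powr_mult sum_distrib_left)
  also have "\<dots> = \<bar>c\<bar> * pnorm p v"
    using assms by (simp add: pnorm_def powr_mult powr_powr sum_nonneg)
  finally show ?thesis .
qed

lemma abs_component_le_pnorm:
  assumes "p > 0"
  shows "\<bar>v $ j\<bar> \<le> pnorm p v"
proof -
  have "\<bar>v $ j\<bar> = (\<bar>v $ j\<bar> powr p) powr (1 / p)"
    using assms by (simp add: powr_powr)
  also have "\<dots> \<le> pnorm p v"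
    unfolding pnorm_def using assms by (intro powr_mono2 member_le_sum) auto
  finally show ?thesis .
qed

lemma norm_le_pnorm:
  fixes v :: "real ^ 'd"
  assumes "p > 0"
  shows "norm v \<le> real CARD('d) * pnorm p v"
proof -
  have "norm v \<le> (\<Sum>j\<in>UNIV. \<bar>v $ j\<bar>)"
    by (rule norm_le_l1_cart)
  also have "\<dots> \<le> (\<Sum>j\<in>(UNIV :: 'd set). pnorm p v)"
    using assms by (intro sum_mono abs_component_le_pnorm)
  finally show ?thesis by simp
qed

lemma pnorm_eq_0_iff: "p > 0 \<Longrightarrow> pnorm p v = 0 \<longleftrightarrow> v = 0"
  using abs_component_le_pnorm[of p v] by (auto simp: pnorm_def vec_eq_iff)

lemma compact_pnorm_between:
  fixes a b :: real
  assumes "p > 0"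
  shows "compact {v :: real ^ 'd. a \<le> pnorm p v \<and> pnorm p v \<le> b}"
proof (rule compact_eq_bounded_closed[THEN iffD2], intro conjI)
  have "norm v \<le> real CARD('d) * b" if "pnorm p v \<le> b" for v :: "real ^ 'd"
    using norm_le_pnorm[OF assms, of v] that
    by (meson mult_left_mono of_nat_0_le_iff order_trans)
  then show "bounded {v :: real ^ 'd. a \<le> pnorm p v \<and> pnorm p v \<le> b}"
    by (auto simp: bounded_iff)
  show "closed {v :: real ^ 'd. a \<le> pnorm p v \<and> pnorm p v \<le> b}"
    by (intro closed_Collect_conj closed_Collect_le continuous_on_pnorm continuous_intros assms)
qed

text \<open>With \<open>s\<close> and \<open>u\<close> the two powers over \<open>a * b\<close>, the
  weighted logarithms cancel, so the Young gap is a positive combination of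
  \<open>s - 1 - ln s\<close> and \<open>u - 1 - ln u\<close>. Each is nonnegative and vanishes only
  at 1, which settles equality.\<close>

lemma Young_real:
  fixes a b p q :: real
  assumes pq: "p > 1" "q > 1" "1 / p + 1 / q = 1" and ab: "a > 0" "b > 0"
  shows "a * b \<le> a powr q / q + b powr p / p"
    and "a * b = a powr q / q + b powr p / p \<Longrightarrow> b powr p = a * b"
proof -
  define s where "s = a powr q / (a * b)"
  define u where "u = b powr p / (a * b)"
  have pos: "s > 0" "u > 0" using ab by (auto simp: s_def u_def)
  have ln: "ln s = q * ln a - (ln a + ln b)" "ln u = p * ln b - (ln a + ln b)"
    using ab by (auto simp: s_def u_def ln_div ln_mult ln_powr)
  have "ln s / q + ln u / p = (ln a + ln b) * (1 - (1 / p + 1 / q))"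
    using pq(1,2) unfolding ln by (simp add: field_simps)
  then have "ln s / q + ln u / p = 0"
    using pq by simp
  moreover have "(s - 1) / q + (u - 1) / p = s / q + u / p - (1 / p + 1 / q)"
    using pq by (simp add: diff_divide_distrib)
  ultimately have eq: "s / q + u / p - 1 = (s - 1 - ln s) / q + (u - 1 - ln u) / p"
    unfolding pq(3) by (simp add: diff_divide_distrib)
  have ge: "s - 1 - ln s \<ge> 0" "u - 1 - ln u \<ge> 0"
    using ln_le_minus_one[OF pos(1)] ln_le_minus_one[OF pos(2)] by auto
  then have ge': "(s - 1 - ln s) / q \<ge> 0" "(u - 1 - ln u) / p \<ge> 0"
    using pq by auto
  have su: "a powr q / q + b powr p / p - a * b = a * b * (s / q + u / p - 1)"
    using ab by (simp add: s_def u_def field_simps)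
  have "a * b * (s / q + u / p - 1) \<ge> 0"
    using ge' ab eq by simp
  then show "a * b \<le> a powr q / q + b powr p / p"
    using su by linarith
  assume "a * b = a powr q / q + b powr p / p"
  then have "a * b * (s / q + u / p - 1) = 0"
    using su by simp
  then have "s / q + u / p - 1 = 0"
    using ab by simp
  then have "(u - 1 - ln u) / p = 0"
    using eq ge' by linarith
  then have "ln u = u - 1" using pq by simp
  then have "u = 1" using ln_eq_minus_one pos by blast
  then show "b powr p = a * b"
    using ab by (simp add: u_def field_simps)
qed

section \<open>Hoelder's inequality and the gradient of the dual norm\<close>

locale conjugate_exponents =
  fixes p q :: real
  assumes p_gt1: "p > 1" and pq: "1 / p + 1 / q = 1"
begin

lemma q_gt1: "q > 1"
proof -
  have "1 / q = 1 - 1 / p" using pq by simp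
  moreover have "1 / p < 1" "1 / p > 0" using p_gt1 by auto
  ultimately have "1 / q > 0" "1 / q < 1" by auto
  then show ?thesis by (simp add: divide_less_eq split: if_splits)
qed

lemma pq_pos: "p > 0" "q > 0" "p \<noteq> 0" "q \<noteq> 0"
  using p_gt1 q_gt1 by auto

lemma exponent_inverse: "(p - 1) * (q - 1) = 1"
  using pq pq_pos by (simp add: field_simps)

lemma exponent_mult: "(q - 1) * p = q"
  using pq pq_pos by (simp add: field_simps)

lemma exponent_inverse_alt: "1 / (p - 1) = q - 1"
  using exponent_inverse p_gt1 by (simp add: field_simps)

text \<open>Passing to absolute values reduces this to \<open>Young_real\<close>; for nonzero
  arguments equality also forces \<open>z * u = \<bar>z\<bar> * \<bar>u\<bar>\<close>, hence equal
  signs.\<close>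

lemma Young_spow:
  fixes z u :: real
  shows "z * u \<le> \<bar>z\<bar> powr q / q + \<bar>u\<bar> powr p / p"
    and "z * u = \<bar>z\<bar> powr q / q + \<bar>u\<bar> powr p / p \<Longrightarrow> u = spow (q - 1) z"
proof -
  note Y = Young_real[OF p_gt1 q_gt1 pq, of "\<bar>z\<bar>" "\<bar>u\<bar>"]
  have zu: "z * u \<le> \<bar>z\<bar> * \<bar>u\<bar>" by (metis abs_ge_self abs_mult)
  show le: "z * u \<le> \<bar>z\<bar> powr q / q + \<bar>u\<bar> powr p / p"
  proof (cases "z = 0 \<or> u = 0")
    case True
    then show ?thesis using pq_pos by auto
  next
    case False
    then show ?thesis using Y zu by auto
  qed
  assume eq: "z * u = \<bar>z\<bar> powr q / q + \<bar>u\<bar> powr p / p"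
  show "u = spow (q - 1) z"
  proof (cases "z = 0 \<or> u = 0")
    case True
    then have "\<bar>z\<bar> powr q / q + \<bar>u\<bar> powr p / p = 0" using eq by auto
    moreover have "\<bar>z\<bar> powr q / q \<ge> 0" "\<bar>u\<bar> powr p / p \<ge> 0" using pq_pos by auto
    ultimately have "\<bar>z\<bar> powr q / q = 0" "\<bar>u\<bar> powr p / p = 0" by linarith+
    then show ?thesis using pq_pos by (auto simp: spow_def)
  next
    case False
    then have pos: "\<bar>z\<bar> > 0" "\<bar>u\<bar> > 0" by auto
    have abs_eq: "\<bar>z\<bar> * \<bar>u\<bar> = z * u"
      using Y(1)[OF pos] eq zu by linarith
    then have "\<bar>u\<bar> powr p = \<bar>z\<bar> * \<bar>u\<bar>"
      using Y(2)[OF pos] eq by simp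
    then have "\<bar>u\<bar> powr (p - 1) = \<bar>z\<bar>"
      using pos by (simp add: powr_diff)
    then have "\<bar>z\<bar> powr (q - 1) = \<bar>u\<bar> powr ((p - 1) * (q - 1))"
      by (metis powr_powr)
    then have "\<bar>z\<bar> powr (q - 1) = \<bar>u\<bar>"
      using pos by (simp add: exponent_inverse)
    moreover have "z * u > 0"
      using abs_eq pos by (metis mult_pos_pos)
    then have "sgn z = sgn u"
      by (auto simp: zero_less_mult_iff)
    ultimately show ?thesis
      by (simp add: spow_def abs_mult_sgn)
  qed
qed

text \<open>Summed over the coordinates, Young's bound totals at most
  \<open>1 / q + 1 / p = 1\<close>. At value 1 no coordinate has slack, so each one is an equality
  case.\<close>

lemma inner_le_Young:
  assumes "pnorm q z \<le> 1" "pnorm p u \<le> 1"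
  shows "z \<bullet> u \<le> 1" and "z \<bullet> u = 1 \<Longrightarrow> u = spow_vec (q - 1) z"
proof -
  let ?f = "\<lambda>j. \<bar>z $ j\<bar> powr q / q + \<bar>u $ j\<bar> powr p / p"
  have "(\<Sum>j\<in>UNIV. ?f j) = pnorm q z powr q / q + pnorm p u powr p / p"
    using pq_pos by (simp add: pnorm_powr sum.distrib sum_divide_distrib)
  also have "\<dots> \<le> 1 / q + 1 / p"
    using assms pq_pos by (intro add_mono divide_right_mono powr_le1) (auto simp: pnorm_nonneg)
  also have "\<dots> = 1" using pq by simp
  finally have f1: "(\<Sum>j\<in>UNIV. ?f j) \<le> 1" .
  have zu: "z \<bullet> u = (\<Sum>j\<in>UNIV. z $ j * u $ j)"
    by (simp add: inner_vec_def)
  have le: "z \<bullet> u \<le> (\<Sum>j\<in>UNIV. ?f j)"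
    unfolding zu by (intro sum_mono Young_spow)
  then show "z \<bullet> u \<le> 1" using f1 by linarith
  assume "z \<bullet> u = 1"
  then have "(\<Sum>j\<in>UNIV. ?f j - z $ j * u $ j) \<le> 0"
    using f1 zu by (simp add: sum_subtractf)
  moreover have nn: "?f j - z $ j * u $ j \<ge> 0" for j
    using Young_spow(1)[of "z $ j" "u $ j"] by linarith
  ultimately have "(\<Sum>j\<in>UNIV. ?f j - z $ j * u $ j) = 0"
    using sum_nonneg[of UNIV "\<lambda>j. ?f j - z $ j * u $ j"] by force
  then have "?f j - z $ j * u $ j = 0" for j
    using nn by (subst (asm) sum_nonneg_eq_0_iff) auto
  then have "u $ j = spow (q - 1) (z $ j)" for j
    by (intro Young_spow(2)) (metis eq_iff_diff_eq_0)
  then show "u = spow_vec (q - 1) z"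
    by (simp add: spow_vec_def vec_eq_iff)
qed

lemma Hoelder_inner: "z \<bullet> u \<le> pnorm q z * pnorm p u"
proof (cases "z = 0 \<or> u = 0")
  case True
  then show ?thesis by (auto simp: pnorm_nonneg)
next
  case False
  then have pos: "pnorm q z > 0" "pnorm p u > 0"
    using pnorm_nonneg pq_pos pnorm_eq_0_iff by (metis less_eq_real_def)+
  have "((1 / pnorm q z) *\<^sub>R z) \<bullet> ((1 / pnorm p u) *\<^sub>R u) \<le> 1"
    using pos by (intro inner_le_Young) (auto simp: pnorm_scaleR pq_pos)
  then show ?thesis using pos by (simp add: field_simps)
qed

text \<open>Away from the origin this is the gradient of \<open>pnorm q\<close> at \<open>z\<close>;
  at the origin it is \<open>0\<close>.\<close>

definition dir :: "real ^ 'd \<Rightarrow> real ^ 'd" where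
  "dir z = (1 / pnorm p (spow_vec (q - 1) z)) *\<^sub>R spow_vec (q - 1) z"

lemma pnorm_spow_vec: "pnorm p (spow_vec (q - 1) z) = pnorm q z powr (q - 1)"
proof -
  have "(1 / q) * (q - 1) = 1 / p"
    using pq pq_pos by (simp add: field_simps)
  then show ?thesis
    by (simp add: pnorm_def spow_vec_def abs_spow powr_powr exponent_mult)
qed

lemma spow_vec_eq_dir: "spow_vec (q - 1) z = (pnorm q z powr (q - 1)) *\<^sub>R dir z"
proof (cases "z = 0")
  case True
  then show ?thesis by (simp add: spow_vec_def spow_def vec_eq_iff dir_def)
next
  case False
  then have "pnorm q z \<noteq> 0" using pnorm_eq_0_iff pq_pos by blast
  then show ?thesis by (simp add: dir_def pnorm_spow_vec)
qed

lemma dir_eq: "dir z = (1 / pnorm q z powr (q - 1)) *\<^sub>R spow_vec (q - 1) z"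
  by (simp add: dir_def pnorm_spow_vec)

lemma pnorm_dir_le: "pnorm p (dir z) \<le> 1"
proof (cases "pnorm p (spow_vec (q - 1) z) = 0")
  case True
  then show ?thesis by (simp add: dir_def pnorm_eq_0_iff[THEN iffD2] pq_pos)
next
  case False
  then show ?thesis using pnorm_nonneg[of p "spow_vec (q - 1) z"]
    by (simp add: dir_def pnorm_scaleR pq_pos)
qed

lemma norm_dir_le: "norm (dir z :: real ^ 'd) \<le> real CARD('d)"
  using norm_le_pnorm[OF pq_pos(1), of "dir z"] pnorm_dir_le[of z]
  by (metis mult.right_neutral mult_left_mono of_nat_0_le_iff order_trans)

lemma inner_dir: "dir z \<bullet> z = pnorm q z"
proof (cases "z = 0")
  case True
  then show ?thesis using pq_pos by (simp add: pnorm_eq_0_iff[THEN iffD2])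
next
  case False
  then have pos: "pnorm q z > 0"
    using pnorm_nonneg pq_pos pnorm_eq_0_iff by (metis less_eq_real_def)
  have t: "spow (q - 1) t * t = \<bar>t\<bar> powr q" for t
    by (cases t "0 :: real" rule: linorder_cases) (auto simp: spow_def powr_diff)
  have "spow_vec (q - 1) z \<bullet> z = (\<Sum>j\<in>UNIV. \<bar>z $ j\<bar> powr q)"
    by (simp add: inner_vec_def spow_vec_def t)
  also have "\<dots> = pnorm q z powr (q - 1) * pnorm q z"
    using pos pq_pos by (simp add: pnorm_powr[symmetric] powr_diff)
  finally show ?thesis using pos by (simp add: dir_eq)
qed

text \<open>\<open>dir\<close> is a subgradient of the dual norm \<open>pnorm q\<close>.\<close>
lemma pnorm_diff_le: "pnorm q a - pnorm q b \<le> dir a \<bullet> (a - b)"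
proof -
  have "dir a \<bullet> b \<le> pnorm q b * pnorm p (dir a)"
    using Hoelder_inner[of b "dir a"] by (simp add: inner_commute)
  also have "\<dots> \<le> pnorm q b"
    using pnorm_dir_le pnorm_nonneg by (metis mult.right_neutral mult_left_mono)
  finally show ?thesis by (simp add: inner_diff_right inner_dir)
qed

text \<open>Bounded subgradients make \<open>pnorm q\<close> Lipschitz for the Euclidean
  norm.\<close>

lemma pnorm_diff_le_norm:
  fixes a b :: "real ^ 'd"
  shows "pnorm q a - pnorm q b \<le> real CARD('d) * norm (a - b)"
proof -
  have "dir a \<bullet> (a - b) \<le> norm (dir a) * norm (a - b)"
    by (rule norm_cauchy_schwarz)
  also have "\<dots> \<le> real CARD('d) * norm (a - b)"
    by (intro mult_right_mono norm_dir_le) auto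
  finally show ?thesis using pnorm_diff_le[of a b] by linarith
qed

lemma dir_scaleR:
  assumes "c > 0"
  shows "dir (c *\<^sub>R z) = dir z"
proof -
  have "spow_vec (q - 1) (c *\<^sub>R z) = (c powr (q - 1)) *\<^sub>R spow_vec (q - 1) z"
    using assms by (simp add: spow_vec_def spow_def vec_eq_iff abs_mult powr_mult sgn_mult)
  then show ?thesis
    using assms by (simp add: dir_eq pnorm_scaleR pq_pos powr_mult pnorm_nonneg)
qed

lemma continuous_on_dir: "continuous_on {z. z \<noteq> 0} dir"
  unfolding dir_eq using pq_pos q_gt1
  by (intro continuous_intros continuous_on_powr' continuous_on_spow_vec continuous_on_pnorm)
    (auto simp: pnorm_nonneg pnorm_eq_0_iff less_eq_real_def)

text \<open>Since \<open>dir\<close> ignores positive scaling, \<open>z\<close> may be put on the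
  unit sphere of \<open>pnorm q\<close>, and compactness of a shell around it gives one
  \<open>\<kappa>\<close>, relative to \<open>pnorm q z\<close>.\<close>

lemma dir_uniformly_continuous:
  fixes e :: real
  assumes "e > 0"
  shows "\<exists>\<kappa>>0. \<forall>z z' :: real ^ 'd. pnorm q z > 0 \<longrightarrow> norm (z' - z) \<le> \<kappa> * pnorm q z \<longrightarrow>
           norm (dir z' - dir z) \<le> e"
proof -
  let ?A = "{v :: real ^ 'd. 1 / 2 \<le> pnorm q v \<and> pnorm q v \<le> 2}"
  have "uniformly_continuous_on ?A dir"
    using pq_pos
    by (intro compact_uniformly_continuous compact_pnorm_between
        continuous_on_subset[OF continuous_on_dir]) (auto simp: pnorm_eq_0_iff[THEN iffD2])
  then obtain d where d: "d > 0"
    "\<And>v v'. v \<in> ?A \<Longrightarrow> v' \<in> ?A \<Longrightarrow> dist v' v < d \<Longrightarrow> dist (dir v') (dir v) < e"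
    unfolding uniformly_continuous_on_def using assms by blast
  \<comment> \<open>The second entry, with the Lipschitz constant of \<open>pnorm q\<close>, keeps
    \<open>v'\<close> inside the shell \<open>?A\<close>.\<close>
  define \<kappa> where "\<kappa> = min (d / 2) (1 / (2 * real CARD('d)))"
  have \<kappa>: "\<kappa> > 0" "\<kappa> < d" "real CARD('d) * \<kappa> \<le> 1 / 2"
    using d(1) by (auto simp: \<kappa>_def min_def field_simps)
  show ?thesis
  proof (intro exI[of _ \<kappa>] conjI allI impI \<kappa>)
    fix z z' :: "real ^ 'd"
    assume pos: "pnorm q z > 0" and le: "norm (z' - z) \<le> \<kappa> * pnorm q z"
    define v v' where "v = (1 / pnorm q z) *\<^sub>R z" and "v' = (1 / pnorm q z) *\<^sub>R z'"
    have Nv: "pnorm q v = 1"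
      using pos by (simp add: v_def pnorm_scaleR pq_pos)
    have "v' - v = (1 / pnorm q z) *\<^sub>R (z' - z)"
      by (simp add: v_def v'_def scaleR_diff_right)
    then have "norm (v' - v) = norm (z' - z) / pnorm q z"
      using pos by simp
    then have nv: "norm (v' - v) \<le> \<kappa>"
      using le pos by (simp add: divide_le_eq)
    then have "real CARD('d) * norm (v' - v) \<le> 1 / 2"
      using \<kappa>(3) by (meson mult_left_mono of_nat_0_le_iff order_trans)
    then have "\<bar>pnorm q v' - pnorm q v\<bar> \<le> 1 / 2"
      using pnorm_diff_le_norm[of v' v] pnorm_diff_le_norm[of v v']
      unfolding norm_minus_commute[of v v'] by linarith
    then have "v \<in> ?A" "v' \<in> ?A"
      using Nv by (auto simp: abs_le_iff, linarith+)
    moreover have "dist v' v < d"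
      using nv \<kappa> by (simp add: dist_norm)
    ultimately have "dist (dir v') (dir v) < e"
      by (rule d(2))
    then show "norm (dir z' - dir z) \<le> e"
      using pos by (simp add: v_def v'_def dir_scaleR dist_norm)
  qed
qed

text \<open>Quantitative equality case of Hoelder: on the compact part of the unit sphere where
  \<open>dir\<close> is at distance at least \<open>e\<close> from \<open>r\<close>, the product
  \<open>v \<bullet> r\<close> never equals 1, so its maximum stays below 1.\<close>

lemma dir_near:
  fixes e :: real and r :: "real ^ 'd"
  assumes e: "e > 0" and r: "pnorm p r \<le> 1"
  shows "\<exists>d>0. d < 1 \<and> (\<forall>z. pnorm q z > 0 \<longrightarrow> z \<bullet> r \<ge> (1 - d) * pnorm q z \<longrightarrow> norm (dir z - r) < e)"
proof -
  let ?S = "{v :: real ^ 'd. 1 \<le> pnorm q v \<and> pnorm q v \<le> 1}"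
  let ?T = "?S \<inter> {v. norm (dir v - r) \<ge> e}"
  have cont: "continuous_on ?S dir"
    using pq_pos by (intro continuous_on_subset[OF continuous_on_dir])
      (auto simp: pnorm_eq_0_iff[THEN iffD2])
  have "compact ?S" using pq_pos by (intro compact_pnorm_between)
  moreover have "closedin (top_of_set ?S) (?S \<inter> (\<lambda>v. norm (dir v - r)) -` {e..})"
    by (intro continuous_closedin_preimage continuous_intros cont)
  moreover have "?S \<inter> (\<lambda>v. norm (dir v - r)) -` {e..} = ?T" by auto
  ultimately have T: "compact ?T"
    using closedin_compact[of ?S ?T] by simp
  have lt1: "v \<bullet> r < 1" if v: "v \<in> ?T" for v
  proof -
    have N: "pnorm q v = 1" using v by auto
    have "r \<noteq> dir v" using v e by auto
    then have "r \<noteq> spow_vec (q - 1) v" using N by (simp add: dir_eq)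
    then show ?thesis using inner_le_Young[of v r] N r by force
  qed
  have "\<exists>s<1. \<forall>v\<in>?T. v \<bullet> r \<le> s"
  proof (cases "?T = {}")
    case True
    then show ?thesis using zero_less_one by (metis empty_iff)
  next
    case False
    moreover have "continuous_on ?T (\<lambda>v. v \<bullet> r)" by (intro continuous_intros)
    ultimately obtain v0 where "v0 \<in> ?T" "\<forall>v\<in>?T. v \<bullet> r \<le> v0 \<bullet> r"
      using continuous_attains_sup[OF T] by blast
    then show ?thesis using lt1 by blast
  qed
  then obtain s where s: "s < 1" "\<And>v. v \<in> ?T \<Longrightarrow> v \<bullet> r \<le> s" by auto
  define d where "d = min (1 / 2) ((1 - s) / 2)"
  have d: "d > 0" "d < 1" "s < 1 - d"
    using s(1) by (auto simp: d_def min_def field_simps)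
  show ?thesis
  proof (intro exI[of _ d] conjI allI impI d)
    fix z :: "real ^ 'd"
    assume pos: "pnorm q z > 0" and ge: "z \<bullet> r \<ge> (1 - d) * pnorm q z"
    define v where "v = (1 / pnorm q z) *\<^sub>R z"
    have "v \<bullet> r \<ge> 1 - d" using pos ge by (simp add: v_def field_simps)
    then have "v \<notin> ?T" using s(2)[of v] d by force
    moreover have "pnorm q v = 1" using pos by (simp add: v_def pnorm_scaleR pq_pos)
    ultimately have "norm (dir v - r) < e" by auto
    then show "norm (dir z - r) < e" using pos by (simp add: v_def dir_scaleR)
  qed
qed

end

section \<open>Gradients as unique derivatives, and record lows of null sequences\<close>

lemma grad_eqI:
  assumes "(f has_derivative (\<lambda>h. g \<bullet> h)) (at w)"
  shows "grad f w = g"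
  unfolding grad_def
proof (rule the_equality)
  show "(f has_derivative (\<lambda>h. g \<bullet> h)) (at w)" by fact
next
  fix g'
  assume "(f has_derivative (\<lambda>h. g' \<bullet> h)) (at w)"
  then have "(\<lambda>h. g' \<bullet> h) = (\<lambda>h. g \<bullet> h)"
    using assms has_derivative_unique by blast
  then have "\<forall>h. g' \<bullet> h = g \<bullet> h" by (simp add: fun_eq_iff)
  then show "g' = g" by (simp only: vector_eq_rdot)
qed

text \<open>The least \<open>k\<close> with \<open>D k\<close> below the first \<open>K + 1\<close> values is a record low.\<close>
lemma record_low:
  fixes D :: "nat \<Rightarrow> real"
  assumes pos: "\<And>k. D k > 0" and lim: "D \<longlonglongrightarrow> 0"
  shows "\<exists>k\<ge>K. \<forall>j\<le>k. D k \<le> D j"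
proof -
  define \<mu> where "\<mu> = Min (D ` {..K})"
  have \<mu>: "\<mu> > 0" "\<And>j. j \<le> K \<Longrightarrow> \<mu> \<le> D j"
    using pos by (auto simp: \<mu>_def)
  then have "\<exists>k. D k < \<mu>"
    using order_tendstoD(2)[OF lim] eventually_happens'[OF sequentially_bot] by blast
  define k where "k = (LEAST k. D k < \<mu>)"
  have k: "D k < \<mu>" unfolding k_def by (rule LeastI_ex) fact
  have least: "D j \<ge> \<mu>" if "j < k" for j
    using not_less_Least[of j "\<lambda>k. D k < \<mu>"] that by (simp add: k_def)
  have "k \<ge> K" using \<mu>(2)[of k] k by force
  moreover have "D k \<le> D j" if "j \<le> k" for j
    using least[of j] k that by (cases "j = k") auto
  ultimately show ?thesis by blast
qed

section \<open>The empirical risk\<close>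

text \<open>Labels are absorbed: \<open>a i\<close> stands for \<open>y i\<close> times
  \<open>x i\<close>, so every margin is \<open>w \<bullet> a i\<close> and separability reads
  \<open>ws \<bullet> a i > 0\<close>.\<close>

locale separable_risk = conjugate_exponents +
  fixes n :: nat and a :: "nat \<Rightarrow> real ^ 'd" and l :: "real \<Rightarrow> real" and ws :: "real ^ 'd"
  assumes n_pos: "n > 0"
    and l_diff: "\<And>z. l differentiable (at z)"
    and l_decr: "antimono l"
    and l_convex: "convex_on UNIV l"
    and l_nomin: "\<And>z. \<exists>z'. l z' < l z"
    and l_bdd: "bdd_below (range l)"
    and ws: "\<And>i. i < n \<Longrightarrow> ws \<bullet> a i > 0"
begin

definition risk :: "real ^ 'd \<Rightarrow> real" where
  "risk w = (1 / real n) * (\<Sum>i<n. l (w \<bullet> a i))"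

definition slope :: "real \<Rightarrow> real" where
  "slope s = - deriv l s"

text \<open>The common scale for the gradient: up to constants it bounds the gradient norm from
  above and the descent along a direction of positive margins from below.\<close>

definition mean_slope :: "real ^ 'd \<Rightarrow> real" where
  "mean_slope w = (1 / real n) * (\<Sum>i<n. slope (w \<bullet> a i))"

definition R :: real where
  "R = (\<Sum>i<n. norm (a i)) + 1"

lemma l_deriv: "(l has_real_derivative - slope s) (at s)"
  using l_diff[of s] by (simp add: slope_def DERIV_deriv_iff_real_differentiable)

lemma l_tangent: "l t \<ge> l s - slope s * (t - s)"
  using convex_on_imp_above_tangent[OF l_convex, of s t "- slope s"] l_deriv[of s]
  by (simp add: algebra_simps)

text \<open>A zero slope would make \<open>s\<close> a minimizer by the tangent inequality, and
  \<open>l\<close> has none.\<close>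

lemma slope_pos: "slope s > 0"
proof -
  have "slope s \<ge> 0"
    using l_tangent[of s "s + 1"] antimonoD[OF l_decr, of s "s + 1"] by simp
  moreover have "slope s \<noteq> 0"
    using l_tangent[of s] l_nomin[of s] by (metis diff_zero leD mult_zero_left)
  ultimately show ?thesis by simp
qed

text \<open>Adding the tangent inequalities at \<open>s\<close> and at \<open>t\<close> cancels the
  values of \<open>l\<close>.\<close>

lemma slope_antimono: "s \<le> t \<Longrightarrow> slope t \<le> slope s"
proof -
  assume st: "s \<le> t"
  have "(slope t - slope s) * (t - s) \<le> 0"
    using l_tangent[of s t] l_tangent[of t s] by (simp add: algebra_simps)
  then show ?thesis using st by (cases "s = t") (auto simp: mult_le_0_iff)
qed

lemma l_strict: "s < t \<Longrightarrow> l t < l s"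
  using l_tangent[of t s] mult_pos_pos[OF slope_pos[of t], of "t - s"]
  by (simp add: algebra_simps)

lemma R_pos: "R > 0"
  by (simp add: R_def add_nonneg_pos sum_nonneg)

lemma norm_a_le: "i < n \<Longrightarrow> norm (a i) \<le> R"
  unfolding R_def using member_le_sum[of i "{..<n}" "\<lambda>i. norm (a i)"] by auto

lemma margin_le: "i < n \<Longrightarrow> \<bar>w \<bullet> a i\<bar> \<le> R * norm w"
  using Cauchy_Schwarz_ineq2[of w "a i"] mult_right_mono[OF norm_a_le[of i], of "norm w"]
  by (simp add: mult.commute)

lemma grad_risk: "grad risk w = - ((1 / real n) *\<^sub>R (\<Sum>i<n. slope (w \<bullet> a i) *\<^sub>R a i))"
proof (rule grad_eqI)
  have "((\<lambda>w. l (w \<bullet> a i)) has_derivative (\<lambda>h. - slope (w \<bullet> a i) * (h \<bullet> a i))) (at w)" for i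
    using has_derivative_compose[OF has_derivative_inner_left[OF has_derivative_ident]
        l_deriv[of "w \<bullet> a i", unfolded has_field_derivative_def]]
    by simp
  then have "(risk has_derivative (\<lambda>h. (1 / real n) * (\<Sum>i<n. - slope (w \<bullet> a i) * (h \<bullet> a i)))) (at w)"
    unfolding risk_def by (intro has_derivative_mult_right has_derivative_sum)
  then show "(risk has_derivative
      (\<lambda>h. - ((1 / real n) *\<^sub>R (\<Sum>i<n. slope (w \<bullet> a i) *\<^sub>R a i)) \<bullet> h)) (at w)"
    by (rule has_derivative_eq_rhs)
      (simp add: fun_eq_iff inner_sum_left inner_sum_right inner_commute sum_negf)
qed

lemma inner_grad_risk:
  "- (grad risk w \<bullet> v) = (1 / real n) * (\<Sum>i<n. slope (w \<bullet> a i) * (v \<bullet> a i))"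
  by (simp add: grad_risk inner_sum_left inner_sum_right inner_commute)

lemma continuous_on_risk: "continuous_on A risk"
proof -
  have "continuous_on UNIV l"
    using l_deriv by (meson DERIV_isCont continuous_at_imp_continuous_on)
  then have "continuous_on A (\<lambda>w. l (w \<bullet> a i))" for i
    by (rule continuous_on_compose2) (intro continuous_intros subset_UNIV)+
  then show ?thesis
    unfolding risk_def by (intro continuous_intros)
qed

lemma risk_tangent: "risk v \<ge> risk w + grad risk w \<bullet> (v - w)"
proof -
  have "(\<Sum>i<n. l (w \<bullet> a i)) - (\<Sum>i<n. slope (w \<bullet> a i) * ((v - w) \<bullet> a i)) \<le> (\<Sum>i<n. l (v \<bullet> a i))"
    unfolding sum_subtractf[symmetric]
  proof (rule sum_mono)
    fix i
    show "l (w \<bullet> a i) - slope (w \<bullet> a i) * ((v - w) \<bullet> a i) \<le> l (v \<bullet> a i)"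
      using l_tangent[of "w \<bullet> a i" "v \<bullet> a i"] by (simp only: inner_diff_left)
  qed
  then have "(1 / real n) * ((\<Sum>i<n. l (w \<bullet> a i)) - (\<Sum>i<n. slope (w \<bullet> a i) * ((v - w) \<bullet> a i)))
      \<le> (1 / real n) * (\<Sum>i<n. l (v \<bullet> a i))"
    by (intro mult_left_mono) auto
  then show ?thesis
    using inner_grad_risk[of w "v - w"] unfolding risk_def right_diff_distrib by linarith
qed

lemma risk_mono: "(\<And>i. i < n \<Longrightarrow> w \<bullet> a i \<le> v \<bullet> a i) \<Longrightarrow> risk v \<le> risk w"
  unfolding risk_def by (intro mult_left_mono sum_mono antimonoD[OF l_decr]) auto

lemma mean_slope_le:
  assumes "\<And>i. i < n \<Longrightarrow> w \<bullet> a i \<ge> s"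
  shows "mean_slope w \<le> slope s"
proof -
  have "(\<Sum>i<n. slope (w \<bullet> a i)) \<le> (\<Sum>i<n. slope s)"
    using assms by (intro sum_mono slope_antimono) auto
  then show ?thesis using n_pos by (simp add: mean_slope_def field_simps)
qed

lemma mean_slope_ge:
  assumes "\<And>i. i < n \<Longrightarrow> w \<bullet> a i \<le> s"
  shows "mean_slope w \<ge> slope s"
proof -
  have "(\<Sum>i<n. slope (w \<bullet> a i)) \<ge> (\<Sum>i<n. slope s)"
    using assms by (intro sum_mono slope_antimono) auto
  then show ?thesis using n_pos by (simp add: mean_slope_def field_simps)
qed

lemma mean_slope_pos: "mean_slope w > 0"
proof -
  have "(\<Sum>i<n. slope (w \<bullet> a i)) > 0"
    using n_pos slope_pos by (intro sum_pos) auto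
  then show ?thesis using n_pos by (simp add: mean_slope_def)
qed

lemma norm_grad_le: "norm (grad risk w) \<le> R * mean_slope w"
proof -
  have "norm (\<Sum>i<n. slope (w \<bullet> a i) *\<^sub>R a i) \<le> (\<Sum>i<n. slope (w \<bullet> a i) * R)"
  proof (rule sum_norm_le)
    fix i assume "i \<in> {..<n}"
    then show "norm (slope (w \<bullet> a i) *\<^sub>R a i) \<le> slope (w \<bullet> a i) * R"
      using slope_pos[of "w \<bullet> a i"] norm_a_le[of i] by (simp add: mult_left_mono)
  qed
  also have "\<dots> = R * (\<Sum>i<n. slope (w \<bullet> a i))"
    by (simp add: sum_distrib_left mult.commute)
  finally show ?thesis
    using n_pos by (simp add: grad_risk mean_slope_def field_simps)
qed

lemma inner_grad_ge:
  assumes "\<And>i. i < n \<Longrightarrow> v \<bullet> a i \<ge> c"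
  shows "- (grad risk w \<bullet> v) \<ge> c * mean_slope w"
proof -
  have "(\<Sum>i<n. slope (w \<bullet> a i) * c) \<le> (\<Sum>i<n. slope (w \<bullet> a i) * (v \<bullet> a i))"
    using assms slope_pos by (intro sum_mono mult_left_mono) (auto intro: less_imp_le)
  then have "(1 / real n) * (\<Sum>i<n. slope (w \<bullet> a i) * c)
      \<le> (1 / real n) * (\<Sum>i<n. slope (w \<bullet> a i) * (v \<bullet> a i))"
    by (intro mult_left_mono) auto
  moreover have "(1 / real n) * (\<Sum>i<n. slope (w \<bullet> a i) * c) = c * mean_slope w"
    by (simp add: mean_slope_def sum_distrib_right[symmetric])
  ultimately show ?thesis by (simp add: inner_grad_risk)
qed

section \<open>The regularization path and its limiting direction\<close>

lemma reg_path_exists: "\<exists>wb. is_reg_path p risk wb"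
proof -
  \<comment> \<open>Minimizers exist on compact balls. Since \<open>reg_direction\<close> quantifies
    over all paths, without a path it would hold vacuously and say nothing about
    \<open>r\<close>.\<close>
  have "\<exists>w. pnorm p w \<le> B \<and> (\<forall>v. pnorm p v \<le> B \<longrightarrow> risk w \<le> risk v)" if "B > 0" for B
  proof -
    let ?S = "{v :: real ^ 'd. 0 \<le> pnorm p v \<and> pnorm p v \<le> B}"
    have "0 \<in> ?S" using that pq_pos by (simp add: pnorm_eq_0_iff[THEN iffD2])
    then have "\<exists>w\<in>?S. \<forall>v\<in>?S. risk w \<le> risk v"
      by (intro continuous_attains_inf compact_pnorm_between continuous_on_risk pq_pos) auto
    then show ?thesis by (auto simp: pnorm_nonneg)
  qed
  then have "\<forall>B. \<exists>w. B > 0 \<longrightarrow> pnorm p w \<le> B \<and> (\<forall>v. pnorm p v \<le> B \<longrightarrow> risk w \<le> risk v)" by blast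
  then show ?thesis unfolding is_reg_path_def by (rule choice)
qed

text \<open>If a margin of \<open>r\<close> vanished, then along the path it would be \<open>o(B)\<close>, and comparison with
  the competitor \<open>B *\<^sub>R w1\<close> gives \<open>l (\<epsilon> B) - l (\<gamma> B) \<le> (n - 1) (l (\<gamma> B) - l (M B))\<close>.
  In terms of the decrements \<open>D k\<close> of \<open>l\<close> on a geometric scale of ratio \<open>M / \<gamma>\<close>, the sum of
  \<open>n\<close> consecutive decrements is at most \<open>n - 1\<close> times the next one, which fails at a record low.\<close>
lemma reg_direction_margin_pos:
  assumes r: "reg_direction p risk r" and i0: "i0 < n"
  shows "r \<bullet> a i0 > 0"
proof (rule ccontr)
  assume "\<not> r \<bullet> a i0 > 0"
  then have r0: "r \<bullet> a i0 \<le> 0" by simp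
  obtain wb where wb: "is_reg_path p risk wb" using reg_path_exists by blast
  then have lim: "((\<lambda>B. (1 / B) *\<^sub>R wb B) \<longlongrightarrow> r) at_top"
    using r by (simp add: reg_direction_def)
  \<comment> \<open>Scaling puts the separator into the unit ball, so that \<open>B\<close> times
    \<open>w1\<close> is a competitor at radius \<open>B\<close>.\<close>
  define w1 where "w1 = (1 / (pnorm p ws + 1)) *\<^sub>R ws"
  have N1: "pnorm p w1 \<le> 1"
    using pnorm_nonneg[of p ws] by (simp add: w1_def pnorm_scaleR pq_pos)
  have w1: "w1 \<bullet> a i > 0" if "i < n" for i
    using ws[OF that] pnorm_nonneg[of p ws] by (simp add: w1_def add_nonneg_pos)
  define \<gamma> where "\<gamma> = Min ((\<lambda>i. w1 \<bullet> a i) ` {..<n})"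
  have \<gamma>: "\<gamma> > 0" "\<And>i. i < n \<Longrightarrow> \<gamma> \<le> w1 \<bullet> a i"
    using w1 n_pos unfolding \<gamma>_def by (subst Min_gr_iff; force) auto
  \<comment> \<open>\<open>R * real CARD('d)\<close> bounds the margins per unit of radius; adding
    \<open>2 * \<gamma>\<close> ensures \<open>\<rho> \<ge> 2\<close>.\<close>
  define M where "M = R * real CARD('d) + 2 * \<gamma>"
  define \<rho> where "\<rho> = M / \<gamma>"
  have M2: "M \<ge> 2 * \<gamma>" using R_pos by (simp add: M_def)
  then have \<rho>: "\<rho> \<ge> 2" using \<gamma> by (simp add: \<rho>_def field_simps)
  \<comment> \<open>Chosen so that \<open>\<epsilon> * B\<close> lies exactly \<open>n\<close>
    scales below \<open>\<gamma> * B\<close>.\<close>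
  define \<epsilon> where "\<epsilon> = \<gamma> / \<rho> ^ n"
  have \<epsilon>: "\<epsilon> > 0" using \<gamma> \<rho> by (simp add: \<epsilon>_def)
  have "((\<lambda>B. ((1 / B) *\<^sub>R wb B) \<bullet> a i0) \<longlongrightarrow> r \<bullet> a i0) at_top"
    by (intro tendsto_intros lim)
  then have "eventually (\<lambda>B. ((1 / B) *\<^sub>R wb B) \<bullet> a i0 < \<epsilon>) at_top"
    by (rule order_tendstoD(2)) (use r0 \<epsilon> in simp)
  then obtain B1 where B1: "\<And>B. B \<ge> B1 \<Longrightarrow> ((1 / B) *\<^sub>R wb B) \<bullet> a i0 < \<epsilon>"
    by (auto simp: eventually_at_top_linorder)
  define D where "D k = l (\<rho> ^ k) - l (\<rho> ^ Suc k)" for k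
  have D_pos: "D k > 0" for k
    unfolding D_def using \<rho> by (simp add: l_strict)
  have "decseq (\<lambda>k. l (\<rho> ^ k))"
    using \<rho> by (intro decseq_SucI antimonoD[OF l_decr]) simp
  moreover obtain b where "\<And>k. b \<le> l (\<rho> ^ k)"
    using l_bdd by (auto simp: bdd_below_def)
  ultimately obtain L where L: "(\<lambda>k. l (\<rho> ^ k)) \<longlonglongrightarrow> L"
    using decseq_convergent by blast
  then have "D \<longlonglongrightarrow> L - L"
    unfolding D_def by (intro tendsto_diff L LIMSEQ_Suc)
  then have D0: "D \<longlonglongrightarrow> 0" by simp
  obtain k0 where k0: "\<rho> ^ k0 > \<gamma> * B1"
    using real_arch_pow[of \<rho> "\<gamma> * B1"] \<rho> by auto
  \<comment> \<open>\<open>k \<ge> k0\<close> brings \<open>B\<close> beyond \<open>B1\<close>;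
    \<open>k \<ge> n\<close> makes \<open>k - n\<close> a true subtraction and leaves
    \<open>n\<close> decrements before \<open>k\<close>.\<close>
  obtain k where k: "k \<ge> max k0 n" and low: "\<And>j. j \<le> k \<Longrightarrow> D k \<le> D j"
    using record_low[OF D_pos D0] by blast
  \<comment> \<open>Then \<open>\<gamma> * B = \<rho> ^ k\<close> and
    \<open>M * B = \<rho> ^ Suc k\<close>.\<close>
  define B where "B = \<rho> ^ k / \<gamma>"
  have B: "B > 0" using \<rho> \<gamma> by (simp add: B_def)
  have "\<rho> ^ k \<ge> \<rho> ^ k0" using k \<rho> by (intro power_increasing) auto
  then have "B \<ge> B1" using k0 \<gamma> by (simp add: B_def field_simps)
  then have "wb B \<bullet> a i0 < \<epsilon> * B"
    using B1[of B] B by (simp add: field_simps)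
  moreover have "\<epsilon> * B = \<rho> ^ (k - n)"
    using k \<gamma> \<rho> by (simp add: B_def \<epsilon>_def power_diff)
  ultimately have low0: "l (\<rho> ^ (k - n)) \<le> l (wb B \<bullet> a i0)"
    by (intro antimonoD[OF l_decr]) simp
  have "pnorm p (wb B) \<le> B" using wb B by (simp add: is_reg_path_def)
  then have nwb: "norm (wb B) \<le> real CARD('d) * B"
    using norm_le_pnorm[OF pq_pos(1), of "wb B"]
    by (meson mult_left_mono of_nat_0_le_iff order_trans)
  have up: "l (\<rho> ^ Suc k) \<le> l (wb B \<bullet> a i)" if "i < n" for i
  proof (rule antimonoD[OF l_decr])
    have "wb B \<bullet> a i \<le> R * (real CARD('d) * B)"
      using margin_le[OF that, of "wb B"] mult_left_mono[OF nwb, of R] R_pos by linarith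
    also have "\<dots> \<le> M * B"
      using B \<gamma> by (simp add: M_def algebra_simps)
    also have "\<dots> = \<rho> ^ Suc k"
      using \<gamma> by (simp add: B_def \<rho>_def)
    finally show "wb B \<bullet> a i \<le> \<rho> ^ Suc k" .
  qed
  have "pnorm p (B *\<^sub>R w1) \<le> B"
    using N1 B by (simp add: pnorm_scaleR pq_pos)
  then have "risk (wb B) \<le> risk (B *\<^sub>R w1)"
    using wb B by (simp add: is_reg_path_def)
  then have le: "(\<Sum>i<n. l (wb B \<bullet> a i)) \<le> (\<Sum>i<n. l ((B *\<^sub>R w1) \<bullet> a i))"
    using n_pos by (simp add: risk_def divide_le_cancel)
  have "(\<Sum>i<n. l ((B *\<^sub>R w1) \<bullet> a i)) \<le> (\<Sum>i<n. l (\<rho> ^ k))"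
  proof (intro sum_mono antimonoD[OF l_decr])
    fix i assume "i \<in> {..<n}"
    then have "\<gamma> * B \<le> (w1 \<bullet> a i) * B" using \<gamma>(2)[of i] B by simp
    then show "\<rho> ^ k \<le> (B *\<^sub>R w1) \<bullet> a i"
      using \<gamma>(1) by (simp add: B_def mult.commute)
  qed
  then have ub: "(\<Sum>i<n. l (wb B \<bullet> a i)) \<le> real n * l (\<rho> ^ k)" using le by simp
  have "(\<Sum>i<n. l (wb B \<bullet> a i)) = l (wb B \<bullet> a i0) + (\<Sum>i\<in>{..<n} - {i0}. l (wb B \<bullet> a i))"
    using i0 by (simp add: sum.remove)
  moreover have "(\<Sum>i\<in>{..<n} - {i0}. l (wb B \<bullet> a i)) \<ge> (\<Sum>i\<in>{..<n} - {i0}. l (\<rho> ^ Suc k))"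
    by (intro sum_mono up) auto
  moreover have "(\<Sum>i\<in>{..<n} - {i0}. l (\<rho> ^ Suc k)) = (real n - 1) * l (\<rho> ^ Suc k)"
    using i0 n_pos by (simp add: of_nat_diff)
  ultimately have lb: "l (\<rho> ^ (k - n)) + (real n - 1) * l (\<rho> ^ Suc k) \<le> (\<Sum>i<n. l (wb B \<bullet> a i))"
    using low0 by linarith
  have tele: "l (\<rho> ^ (k - n)) - l (\<rho> ^ k) = (\<Sum>j = k - n..<k. D j)"
    unfolding D_def using sum_Suc_diff'[of "k - n" k "\<lambda>j. - l (\<rho> ^ j)"] by (simp add: sum_subtractf)
  \<comment> \<open>Each of the \<open>n\<close> decrements before \<open>k\<close> is at least the
    record low \<open>D k\<close>.\<close>
  have "(\<Sum>j = k - n..<k. D k) \<le> (\<Sum>j = k - n..<k. D j)"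
    by (intro sum_mono low) auto
  then have "real n * D k \<le> l (\<rho> ^ (k - n)) - l (\<rho> ^ k)"
    using tele k by simp
  moreover have "l (\<rho> ^ (k - n)) - l (\<rho> ^ k) \<le> (real n - 1) * D k"
    using lb ub by (simp add: D_def algebra_simps)
  ultimately show False using D_pos[of k] by (simp add: algebra_simps)
qed

text \<open>The rescaled path stays in the closed unit ball of \<open>pnorm p\<close>.\<close>

lemma pnorm_reg_direction_le:
  assumes r: "reg_direction p risk r"
  shows "pnorm p r \<le> 1"
proof -
  obtain wb where wb: "is_reg_path p risk wb" using reg_path_exists by blast
  then have "((\<lambda>B. (1 / B) *\<^sub>R wb B) \<longlongrightarrow> r) at_top"
    using r by (simp add: reg_direction_def)
  moreover have "eventually (\<lambda>B. (1 / B) *\<^sub>R wb B \<in> {v. 0 \<le> pnorm p v \<and> pnorm p v \<le> 1}) at_top"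
    using eventually_gt_at_top[of 0]
  proof eventually_elim
    case (elim B)
    then show ?case using wb
      by (simp add: is_reg_path_def pnorm_scaleR pq_pos pnorm_nonneg)
  qed
  ultimately have "r \<in> {v. 0 \<le> pnorm p v \<and> pnorm p v \<le> 1}"
    using pq_pos by (intro Lim_in_closed_set[OF compact_imp_closed[OF compact_pnorm_between]]) auto
  then show ?thesis by simp
qed

text \<open>All margins of \<open>r\<close> are positive, so the factor \<open>1 + \<alpha>\<close>
  eventually lifts those of \<open>(B * (1 + \<alpha>)) *\<^sub>R r\<close> above those of
  \<open>wb B\<close>; and \<open>wb B\<close> is optimal in the ball of radius
  \<open>B = pnorm p w\<close>.\<close>

lemma risk_reg_direction_le:
  assumes r: "reg_direction p risk r" and \<alpha>: "\<alpha> > 0"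
  shows "\<exists>B0>0. \<forall>w. pnorm p w \<ge> B0 \<longrightarrow> risk ((pnorm p w * (1 + \<alpha>)) *\<^sub>R r) \<le> risk w"
proof -
  obtain wb where wb: "is_reg_path p risk wb" using reg_path_exists by blast
  then have lim: "((\<lambda>B. (1 / B) *\<^sub>R wb B) \<longlongrightarrow> r) at_top"
    using r by (simp add: reg_direction_def)
  have "eventually (\<lambda>B. ((1 / B) *\<^sub>R wb B) \<bullet> a i < (1 + \<alpha>) * (r \<bullet> a i)) at_top" if "i < n" for i
  proof (rule order_tendstoD(2))
    show "((\<lambda>B. ((1 / B) *\<^sub>R wb B) \<bullet> a i) \<longlongrightarrow> r \<bullet> a i) at_top"
      by (intro tendsto_intros lim)
    show "r \<bullet> a i < (1 + \<alpha>) * (r \<bullet> a i)"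
      using reg_direction_margin_pos[OF r that] \<alpha> by simp
  qed
  then have "eventually (\<lambda>B. \<forall>i\<in>{..<n}. ((1 / B) *\<^sub>R wb B) \<bullet> a i < (1 + \<alpha>) * (r \<bullet> a i)) at_top"
    by (intro eventually_ball_finite) auto
  then obtain B1 where B1:
    "\<And>B i. B \<ge> B1 \<Longrightarrow> i < n \<Longrightarrow> ((1 / B) *\<^sub>R wb B) \<bullet> a i < (1 + \<alpha>) * (r \<bullet> a i)"
    by (auto simp: eventually_at_top_linorder)
  show ?thesis
  proof (intro exI[of _ "max 1 B1"] conjI allI impI)
    fix w :: "real ^ 'd"
    assume B: "pnorm p w \<ge> max 1 B1"
    define B where "B = pnorm p w"
    have "wb B \<bullet> a i \<le> ((B * (1 + \<alpha>)) *\<^sub>R r) \<bullet> a i" if "i < n" for i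
      using B1[of B i] B that by (simp add: B_def divide_less_eq mult_ac)
    then have "risk ((B * (1 + \<alpha>)) *\<^sub>R r) \<le> risk (wb B)" by (rule risk_mono)
    also have "\<dots> \<le> risk w" using wb B by (simp add: is_reg_path_def B_def)
    finally show "risk ((pnorm p w * (1 + \<alpha>)) *\<^sub>R r) \<le> risk w" by (simp add: B_def)
  qed simp
qed

end

section \<open>The dual iterates\<close>

locale regularized_risk = separable_risk p q n a l ws
  for p q n and a :: "nat \<Rightarrow> real ^ 'd" and l ws +
  fixes r :: "real ^ 'd"
  assumes r: "reg_direction p risk r"
begin

abbreviation N :: "real ^ 'd \<Rightarrow> real" where
  "N \<equiv> pnorm q"

abbreviation primal :: "real ^ 'd \<Rightarrow> real ^ 'd" where
  "primal \<equiv> spow_vec (q - 1)"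

definition dgrad :: "real ^ 'd \<Rightarrow> real ^ 'd" where
  "dgrad z = grad risk (primal z)"

primrec dual :: "real \<Rightarrow> real ^ 'd \<Rightarrow> nat \<Rightarrow> real ^ 'd" where
  "dual \<eta> z0 0 = z0"
| "dual \<eta> z0 (Suc t) = dual \<eta> z0 t - \<eta> *\<^sub>R dgrad (dual \<eta> z0 t)"

text \<open>\<open>spow_vec (p - 1)\<close> undoes \<open>primal\<close>, so a p-GD step recovers
  the dual iterate, moves it, and maps it back, as \<open>1 / (p - 1) = q - 1\<close>.\<close>

lemma pgd_eq_primal_dual: "pgd p \<eta> risk w0 t = primal (dual \<eta> (spow_vec (p - 1) w0) t)"
proof (induction t)
  case 0
  show ?case using exponent_inverse by (simp add: spow_vec_spow_vec)
next
  case (Suc t)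
  let ?z = "dual \<eta> (spow_vec (p - 1) w0) t"
  have "spow_vec (p - 1) (primal ?z) = ?z"
    using exponent_inverse by (intro spow_vec_spow_vec) (simp add: mult.commute)
  then have "\<bar>primal ?z $ j\<bar> powr (p - 1) * sgn (primal ?z $ j) = ?z $ j" for j
    by (simp add: spow_vec_def spow_def vec_eq_iff)
  then show ?case
    by (simp add: Suc pgd_step_def exponent_inverse_alt dgrad_def Let_def)
      (simp add: spow_vec_def spow_def)
qed

lemma normalized_primal: "(1 / pnorm p (primal z)) *\<^sub>R primal z = dir z"
  by (simp add: dir_def)

definition margin :: real where
  "margin = Min ((\<lambda>i. r \<bullet> a i) ` {..<n})"

lemma margin_pos: "margin > 0"
proof -
  have "margin \<in> (\<lambda>i. r \<bullet> a i) ` {..<n}"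
    unfolding margin_def using n_pos by (intro Min_in) auto
  then show ?thesis using reg_direction_margin_pos[OF r] by auto
qed

lemma margin_le_r: "i < n \<Longrightarrow> margin \<le> r \<bullet> a i"
  by (simp add: margin_def)

lemma inner_dgrad_r: "- (dgrad z \<bullet> r) \<ge> margin * mean_slope (primal z)"
  unfolding dgrad_def by (rule inner_grad_ge) (rule margin_le_r)

lemma inner_dgrad_r_pos: "- (dgrad z \<bullet> r) > 0"
  using inner_dgrad_r[of z] mult_pos_pos[OF margin_pos mean_slope_pos, of "primal z"] by linarith

text \<open>Both sides are compared with \<open>mean_slope\<close>. Any error proportional to the
  gradient can thus be charged to the growth of \<open>z \<bullet> r\<close>.\<close>

lemma norm_dgrad_le: "norm (dgrad z) \<le> R / margin * - (dgrad z \<bullet> r)"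
proof -
  have "norm (dgrad z) \<le> R * mean_slope (primal z)"
    unfolding dgrad_def by (rule norm_grad_le)
  also have "\<dots> = R / margin * (margin * mean_slope (primal z))"
    using margin_pos by simp
  also have "\<dots> \<le> R / margin * - (dgrad z \<bullet> r)"
    using inner_dgrad_r[of z] R_pos margin_pos by (intro mult_left_mono) auto
  finally show ?thesis .
qed

lemma inner_r_le: "z \<bullet> r \<le> N z"
  using Hoelder_inner[of z r] pnorm_reg_direction_le[OF r] pnorm_nonneg[of q z]
  by (smt (verit) mult_left_le)

text \<open>No smoothness of the loss is used: by convexity of \<open>N\<close> the error of one step is controlled by
  \<open>dir z' - dir z\<close>, which is small once the step is short relative to \<open>N z\<close>.\<close>
lemma one_step:
  assumes \<delta>: "\<delta> > 0"
  shows "\<exists>Ns>0. \<exists>\<kappa>>0. \<forall>z \<eta>. Ns \<le> N z \<longrightarrow> 0 < \<eta> \<longrightarrow> \<eta> * norm (dgrad z) \<le> \<kappa> * N z \<longrightarrow>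
    N (z - \<eta> *\<^sub>R dgrad z) - N z \<le> (1 + \<delta>) * (\<eta> * - (dgrad z \<bullet> r))"
proof -
  \<comment> \<open>Half of \<open>\<delta>\<close> pays for the comparison with \<open>r\<close>,
    half for the turn of \<open>dir\<close> during the step.\<close>
  define \<alpha> where "\<alpha> = \<delta> / 2"
  have \<alpha>: "\<alpha> > 0" using \<delta> by (simp add: \<alpha>_def)
  obtain B0 where B0: "B0 > 0"
    "\<And>w. pnorm p w \<ge> B0 \<Longrightarrow> risk ((pnorm p w * (1 + \<alpha>)) *\<^sub>R r) \<le> risk w"
    using risk_reg_direction_le[OF r \<alpha>] by blast
  \<comment> \<open>Balances the factor \<open>R / margin\<close> of \<open>norm_dgrad_le\<close>,
    leaving \<open>\<alpha>\<close>.\<close>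
  define e where "e = \<alpha> * margin / R"
  have e: "e > 0" using \<alpha> margin_pos R_pos by (simp add: e_def)
  obtain \<kappa> where \<kappa>: "\<kappa> > 0"
    "\<And>z z' :: real ^ 'd. N z > 0 \<Longrightarrow> norm (z' - z) \<le> \<kappa> * N z \<Longrightarrow> norm (dir z' - dir z) \<le> e"
    using dir_uniformly_continuous[OF e, where 'd = 'd] by blast
  \<comment> \<open>As \<open>pnorm p (primal z) = N z powr (q - 1)\<close>, the bound
    \<open>Ns \<le> N z\<close> puts the primal point beyond \<open>B0\<close>.\<close>
  define Ns where "Ns = B0 powr (p - 1)"
  have Ns: "Ns > 0" using B0(1) by (simp add: Ns_def)
  show ?thesis
  proof (rule exI[of _ Ns], intro conjI Ns exI[of _ \<kappa>] \<kappa>(1) allI impI)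
    fix z :: "real ^ 'd" and \<eta> :: real
    assume z: "Ns \<le> N z" and \<eta>: "0 < \<eta>" and le: "\<eta> * norm (dgrad z) \<le> \<kappa> * N z"
    define w g z' where "w = primal z" and "g = dgrad z" and "z' = z - \<eta> *\<^sub>R g"
    have pos: "N z > 0" using z Ns by linarith
    have "B0 = (B0 powr (p - 1)) powr (q - 1)"
      using B0(1) by (simp add: powr_powr exponent_inverse)
    also have "\<dots> \<le> N z powr (q - 1)"
      using z q_gt1 by (intro powr_mono2) (auto simp: Ns_def)
    also have "\<dots> = pnorm p w" by (simp add: w_def pnorm_spow_vec)
    finally have wB: "pnorm p w \<ge> B0" .
    define B where "B = pnorm p w"
    have B: "B > 0" using wB B0(1) by (simp add: B_def)
    \<comment> \<open>Convexity at \<open>w\<close>, tested at the competitor along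
      \<open>r\<close>, whose risk is no larger.\<close>
    have "risk w + g \<bullet> ((B * (1 + \<alpha>)) *\<^sub>R r - w) \<le> risk w"
      using risk_tangent[of w "(B * (1 + \<alpha>)) *\<^sub>R r"] B0(2)[OF wB]
      by (simp add: g_def dgrad_def w_def B_def)
    then have "g \<bullet> ((B * (1 + \<alpha>)) *\<^sub>R r - w) \<le> 0" by simp
    moreover have "w = B *\<^sub>R dir z"
      using B by (simp add: B_def w_def dir_def)
    ultimately have "B * ((1 + \<alpha>) * (g \<bullet> r) - g \<bullet> dir z) \<le> 0"
      by (simp add: inner_diff_right algebra_simps)
    then have "(1 + \<alpha>) * (g \<bullet> r) \<le> g \<bullet> dir z"
      using B by (simp add: mult_le_0_iff)
    then have main: "\<eta> * - (g \<bullet> dir z) \<le> \<eta> * ((1 + \<alpha>) * - (g \<bullet> r))"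
      using \<eta> by (intro mult_left_mono) auto
    have "norm (z' - z) \<le> \<kappa> * N z"
      using le \<eta> by (simp add: z'_def g_def)
    then have near: "norm (dir z' - dir z) \<le> e" using \<kappa>(2) pos by blast
    have "- (g \<bullet> (dir z' - dir z)) \<le> norm g * norm (dir z' - dir z)"
      using Cauchy_Schwarz_ineq2[of g "dir z' - dir z"] by linarith
    also have "\<dots> \<le> (R / margin * - (g \<bullet> r)) * e"
      using norm_dgrad_le[of z] near order_trans[OF norm_ge_zero norm_dgrad_le[of z]]
      unfolding g_def by (intro mult_mono) auto
    also have "\<dots> = \<alpha> * - (g \<bullet> r)"
      using R_pos margin_pos by (simp add: e_def)
    finally have err: "\<eta> * - (g \<bullet> (dir z' - dir z)) \<le> \<eta> * (\<alpha> * - (g \<bullet> r))"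
      using \<eta> by (intro mult_left_mono) auto
    \<comment> \<open>The subgradient is taken at the new point \<open>z'\<close>, so the error is
      the difference of two values of \<open>dir\<close>.\<close>
    have "N z' - N z \<le> dir z' \<bullet> (z' - z)" by (rule pnorm_diff_le)
    also have "\<dots> = \<eta> * - (g \<bullet> dir z) + \<eta> * - (g \<bullet> (dir z' - dir z))"
      by (simp add: z'_def inner_diff_right inner_commute algebra_simps)
    also have "\<dots> \<le> \<eta> * ((1 + \<alpha>) * - (g \<bullet> r)) + \<eta> * (\<alpha> * - (g \<bullet> r))"
      using main err by linarith
    also have "\<dots> = (1 + \<delta>) * (\<eta> * - (g \<bullet> r))"
      by (simp add: \<alpha>_def algebra_simps)
    finally show "N (z - \<eta> *\<^sub>R dgrad z) - N z \<le> (1 + \<delta>) * (\<eta> * - (dgrad z \<bullet> r))"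
      by (simp add: z'_def g_def)
  qed
qed

text \<open>When \<open>dir z\<close> is within \<open>margin / R\<close> of \<open>r\<close>, a
  product with \<open>a i\<close> drops by at most \<open>margin\<close>, which is what
  \<open>r\<close> has to spare; \<open>primal z\<close> is a nonnegative multiple of
  \<open>dir z\<close>.\<close>

lemma margins_nonneg_near:
  "\<exists>d>0. d < 1 \<and> (\<forall>z. N z > 0 \<longrightarrow> z \<bullet> r \<ge> (1 - d) * N z \<longrightarrow> (\<forall>i<n. primal z \<bullet> a i \<ge> 0))"
proof -
  have e: "margin / R > 0" using margin_pos R_pos by simp
  obtain d where d: "d > 0" "d < 1"
    "\<And>z. N z > 0 \<Longrightarrow> z \<bullet> r \<ge> (1 - d) * N z \<Longrightarrow> norm (dir z - r) < margin / R"
    using dir_near[OF e pnorm_reg_direction_le[OF r]] by blast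
  have "primal z \<bullet> a i \<ge> 0" if "N z > 0" "z \<bullet> r \<ge> (1 - d) * N z" "i < n" for z i
  proof -
    have "\<bar>(dir z - r) \<bullet> a i\<bar> \<le> R * norm (dir z - r)" by (rule margin_le[OF that(3)])
    also have "\<dots> \<le> margin" using d(3)[OF that(1,2)] R_pos by (simp add: field_simps)
    finally have "dir z \<bullet> a i \<ge> 0"
      using margin_le_r[OF that(3)] by (simp add: inner_diff_left)
    then show ?thesis by (simp add: spow_vec_eq_dir)
  qed
  then show ?thesis using d(1,2) by blast
qed

lemma abs_margin_primal_le:
  assumes "N z \<le> b" "i < n"
  shows "\<bar>primal z \<bullet> a i\<bar> \<le> R * (b powr (q - 1) * real CARD('d))"
proof -
  have "norm (primal z) \<le> b powr (q - 1) * real CARD('d)"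
    unfolding spow_vec_eq_dir norm_scaleR using assms(1) q_gt1 norm_dir_le[of z]
    by (intro mult_mono) (auto intro!: powr_mono2 simp: pnorm_nonneg)
  then show ?thesis
    using margin_le[OF assms(2), of "primal z"] R_pos by (meson mult_left_mono less_imp_le order_trans)
qed

text \<open>For small \<open>\<eta>\<close> the quantity \<open>(1 + \<delta>) * (z \<bullet> r) - N z\<close> stays above \<open>- K\<close> along the dual iterates.
  Hence \<open>z\<close> is either bounded by \<open>Nb\<close> or so close to the direction \<open>r\<close> that all margins are
  nonnegative, and the gradient is bounded in both cases.\<close>
lemma dgrad_bounded:
  "\<exists>G>0. \<exists>\<eta>0>0. \<forall>\<eta>. 0 < \<eta> \<and> \<eta> < \<eta>0 \<longrightarrow> (\<forall>t. norm (dgrad (dual \<eta> z0 t)) \<le> G)"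
proof -
  obtain d where d: "d > 0" "d < 1"
    "\<And>z i. N z > 0 \<Longrightarrow> z \<bullet> r \<ge> (1 - d) * N z \<Longrightarrow> i < n \<Longrightarrow> primal z \<bullet> a i \<ge> 0"
    using margins_nonneg_near by blast
  define \<delta> where "\<delta> = d / 2"
  have \<delta>: "\<delta> > 0" using d by (simp add: \<delta>_def)
  obtain Ns \<kappa> where Ns: "Ns > 0" and \<kappa>: "\<kappa> > 0" and N_step:
    "\<And>z \<eta>. Ns \<le> N z \<Longrightarrow> 0 < \<eta> \<Longrightarrow> \<eta> * norm (dgrad z) \<le> \<kappa> * N z \<Longrightarrow>
      N (z - \<eta> *\<^sub>R dgrad z) - N z \<le> (1 + \<delta>) * (\<eta> * - (dgrad z \<bullet> r))"
    using one_step[OF \<delta>] by blast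
  \<comment> \<open>Large enough for the initial value and for a step starting below
    \<open>Ns\<close>, which ends with norm at most \<open>Ns + 1\<close>.\<close>
  define K where "K = (1 + \<delta>) * \<bar>z0 \<bullet> r\<bar> + N z0 + Ns + 1"
  have K: "K > 0"
    using \<delta> Ns pnorm_nonneg[of q z0] by (simp add: K_def add_nonneg_pos)
  \<comment> \<open>Beyond \<open>Nb\<close> the constant \<open>K\<close> is at most
    \<open>d / 2\<close> times \<open>N z\<close>.\<close>
  define Nb where "Nb = 2 * K / d"
  have Nb: "Nb > 0" using K d by (simp add: Nb_def)
  define M where "M = R * (Nb powr (q - 1) * real CARD('d))"
  have M: "M \<ge> 0" using R_pos by (simp add: M_def)
  define G where "G = R * slope (- M)"
  have G: "G > 0" using R_pos slope_pos by (simp add: G_def)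
  \<comment> \<open>For gradients bounded by \<open>G\<close>, the first entry makes steps
    admissible for \<open>N_step\<close> where \<open>N z \<ge> Ns\<close>; the second lets
    \<open>N\<close> grow by at most 1 in a step.\<close>
  define \<eta>0 where "\<eta>0 = min (\<kappa> * Ns / G) (1 / (real CARD('d) * G))"
  have \<eta>0: "\<eta>0 > 0" using \<kappa> Ns G by (simp add: \<eta>0_def)
  have bound: "norm (dgrad z) \<le> G" if inv: "(1 + \<delta>) * (z \<bullet> r) - N z \<ge> - K" for z
  proof -
    have "primal z \<bullet> a i \<ge> - M" if i: "i < n" for i
    proof (cases "N z \<le> Nb")
      case True
      then show ?thesis using abs_margin_primal_le[OF True i] by (simp add: M_def)
    next
      case False
      then have pos: "N z > 0" using Nb by linarith
      have "K = (d / 2) * Nb" using d by (simp add: Nb_def)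
      also have "\<dots> \<le> (d / 2) * N z" using False d by (intro mult_left_mono) auto
      finally have "(1 + d / 2) * (z \<bullet> r) \<ge> (1 - d / 2) * N z"
        using inv by (simp add: \<delta>_def algebra_simps)
      \<comment> \<open>\<open>(1 + d / 2) * (1 - d) = 1 - d / 2 - d ^ 2 / 2\<close>.\<close>
      moreover have "(1 - d / 2) * N z \<ge> ((1 + d / 2) * (1 - d)) * N z"
        using pos by (intro mult_right_mono) (auto simp: algebra_simps)
      ultimately have "(1 + d / 2) * ((1 - d) * N z) \<le> (1 + d / 2) * (z \<bullet> r)"
        by (simp add: mult.assoc)
      then have "(1 - d) * N z \<le> z \<bullet> r" using d by (simp add: mult_le_cancel_left)
      then show ?thesis using d(3)[OF pos _ i] M by force
    qed
    then have "mean_slope (primal z) \<le> slope (- M)" by (rule mean_slope_le)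
    then have "R * mean_slope (primal z) \<le> G"
      unfolding G_def using R_pos by (intro mult_left_mono) auto
    then show ?thesis
      using norm_grad_le[of "primal z"] by (simp add: dgrad_def)
  qed
  show ?thesis
  proof (rule exI[of _ G], intro conjI G exI[of _ \<eta>0] \<eta>0 allI impI)
    fix \<eta> t
    assume \<eta>: "0 < \<eta> \<and> \<eta> < \<eta>0"
    have \<eta>1: "\<eta> * G \<le> \<kappa> * Ns" "real CARD('d) * (\<eta> * G) \<le> 1"
      using \<eta> G by (auto simp: \<eta>0_def field_simps)
    let ?z = "dual \<eta> z0"
    \<comment> \<open>The first conjunct serves iterates with \<open>N z < Ns\<close>, where
      \<open>N_step\<close> is silent: there the Lipschitz bound on \<open>N\<close> and a lower
      bound on \<open>z \<bullet> r\<close> suffice.\<close>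
    have "z0 \<bullet> r \<le> ?z t \<bullet> r \<and> (1 + \<delta>) * (?z t \<bullet> r) - N (?z t) \<ge> - K"
    proof (induction t)
      case 0
      have "(1 + \<delta>) * (z0 \<bullet> r) \<ge> (1 + \<delta>) * - \<bar>z0 \<bullet> r\<bar>"
        using \<delta> by (intro mult_left_mono) auto
      then show ?case using Ns by (simp add: K_def)
    next
      case (Suc t)
      define z g where "z = ?z t" and "g = dgrad z"
      have z': "?z (Suc t) = z - \<eta> *\<^sub>R g" by (simp add: z_def g_def)
      have IH: "z0 \<bullet> r \<le> z \<bullet> r" "(1 + \<delta>) * (z \<bullet> r) - N z \<ge> - K"
        using Suc by (auto simp: z_def)
      have gG: "\<eta> * norm g \<le> \<eta> * G"
        unfolding g_def using \<eta> by (intro mult_left_mono bound IH) auto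
      have inc: "\<eta> * - (g \<bullet> r) > 0"
        unfolding g_def using \<eta> by (intro mult_pos_pos inner_dgrad_r_pos) auto
      have z'r: "(z - \<eta> *\<^sub>R g) \<bullet> r = z \<bullet> r + \<eta> * - (g \<bullet> r)"
        by (simp add: inner_diff_left)
      have mono: "z0 \<bullet> r \<le> (z - \<eta> *\<^sub>R g) \<bullet> r" using IH inc z'r by linarith
      have "(1 + \<delta>) * ((z - \<eta> *\<^sub>R g) \<bullet> r) - N (z - \<eta> *\<^sub>R g) \<ge> - K"
      proof (cases "Ns \<le> N z")
        case True
        have "\<eta> * norm g \<le> \<kappa> * N z"
          using gG \<eta>1(1) mult_left_mono[OF True, of \<kappa>] \<kappa> by linarith
        then have "N (z - \<eta> *\<^sub>R g) - N z \<le> (1 + \<delta>) * (\<eta> * - (g \<bullet> r))"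
          unfolding g_def using True \<eta> by (intro N_step) auto
        then show ?thesis using IH(2) unfolding z'r distrib_left[of "1 + \<delta>"] by linarith
      next
        case False
        have "N (z - \<eta> *\<^sub>R g) - N z \<le> real CARD('d) * norm (z - \<eta> *\<^sub>R g - z)"
          by (rule pnorm_diff_le_norm)
        also have "\<dots> = real CARD('d) * (\<eta> * norm g)" using \<eta> by simp
        also have "\<dots> \<le> real CARD('d) * (\<eta> * G)" by (intro mult_left_mono gG) auto
        also have "\<dots> \<le> 1" by (rule \<eta>1)
        finally have "N (z - \<eta> *\<^sub>R g) \<le> Ns + 1" using False by linarith
        moreover have "(1 + \<delta>) * ((z - \<eta> *\<^sub>R g) \<bullet> r) \<ge> (1 + \<delta>) * - \<bar>z0 \<bullet> r\<bar>"
          using \<delta> mono by (intro mult_left_mono) auto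
        ultimately show ?thesis using pnorm_nonneg[of q z0] by (simp add: K_def)
      qed
      then show ?case using mono z' by simp
    qed
    then show "norm (dgrad (?z t)) \<le> G" by (intro bound) simp
  qed
qed

section \<open>Divergence of the dual iterates and alignment with \<open>r\<close>\<close>

lemma dual_inner_incseq:
  assumes "\<eta> > 0"
  shows "incseq (\<lambda>t. dual \<eta> z0 t \<bullet> r)"
proof (rule incseq_SucI)
  fix t
  show "dual \<eta> z0 t \<bullet> r \<le> dual \<eta> z0 (Suc t) \<bullet> r"
    using mult_pos_pos[OF assms inner_dgrad_r_pos, of "dual \<eta> z0 t"] by (simp add: inner_diff_left)
qed

text \<open>Were \<open>z \<bullet> r\<close> bounded, so would be \<open>N z\<close>, each step
  being charged to an increase of \<open>z \<bullet> r\<close>. Bounded margins keep the slopes away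
  from zero, and \<open>z \<bullet> r\<close> would grow linearly.\<close>

lemma dual_inner_at_top:
  assumes \<eta>: "\<eta> > 0"
  shows "filterlim (\<lambda>t. dual \<eta> z0 t \<bullet> r) at_top sequentially"
proof (rule ccontr)
  let ?z = "dual \<eta> z0"
  assume "\<not> ?thesis"
  then obtain b where b: "\<not> eventually (\<lambda>t. ?z t \<bullet> r \<ge> b) sequentially"
    unfolding filterlim_at_top by blast
  have bdd: "?z t \<bullet> r \<le> b" for t
  proof (rule ccontr)
    assume "\<not> ?z t \<bullet> r \<le> b"
    then have "?z s \<bullet> r \<ge> b" if "s \<ge> t" for s
      using incseqD[OF dual_inner_incseq[OF \<eta>, of z0] that] by linarith
    then show False using b by (auto simp: eventually_sequentially)
  qed
  define c where "c = real CARD('d) * (R / margin)"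
  have c: "c \<ge> 0" using R_pos margin_pos by (simp add: c_def)
  have "N (?z t) \<le> N z0 + c * (?z t \<bullet> r - z0 \<bullet> r)" for t
  proof (induction t)
    case (Suc t)
    let ?g = "dgrad (?z t)"
    have "N (?z (Suc t)) - N (?z t) \<le> real CARD('d) * norm (?z (Suc t) - ?z t)"
      by (rule pnorm_diff_le_norm)
    also have "\<dots> = real CARD('d) * (\<eta> * norm ?g)" using \<eta> by simp
    also have "\<dots> \<le> real CARD('d) * (\<eta> * (R / margin * - (?g \<bullet> r)))"
      using \<eta> norm_dgrad_le by (intro mult_left_mono) auto
    also have "\<dots> = c * (?z (Suc t) \<bullet> r - ?z t \<bullet> r)"
      by (simp add: c_def inner_diff_left)
    finally show ?case using Suc by (simp add: right_diff_distrib)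
  qed simp
  moreover have "c * (?z t \<bullet> r - z0 \<bullet> r) \<le> c * (b - z0 \<bullet> r)" for t
    using c bdd by (intro mult_left_mono) auto
  ultimately have Nb: "N (?z t) \<le> N z0 + c * (b - z0 \<bullet> r)" for t
    by (meson add_left_mono order_trans)
  define M where "M = R * ((N z0 + c * (b - z0 \<bullet> r)) powr (q - 1) * real CARD('d))"
  define s where "s = \<eta> * (margin * slope M)"
  have s: "s > 0" using \<eta> margin_pos slope_pos by (simp add: s_def)
  have "z0 \<bullet> r + real t * s \<le> ?z t \<bullet> r" for t
  proof (induction t)
    case (Suc t)
    have "mean_slope (primal (?z t)) \<ge> slope M"
    proof (rule mean_slope_ge)
      show "primal (?z t) \<bullet> a i \<le> M" if "i < n" for i
        using abs_margin_primal_le[OF Nb that, of t] by (simp add: M_def)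
    qed
    then have "margin * slope M \<le> - (dgrad (?z t) \<bullet> r)"
      using inner_dgrad_r[of "?z t"] margin_pos by (meson mult_left_mono less_imp_le order_trans)
    then have "s \<le> \<eta> * - (dgrad (?z t) \<bullet> r)"
      unfolding s_def using \<eta> by (intro mult_left_mono) auto
    then show ?case using Suc by (simp add: inner_diff_left algebra_simps)
  qed simp
  moreover obtain t where "real t * s > b - z0 \<bullet> r"
    using reals_Archimedean3[OF s] by blast
  ultimately show False using bdd[of t] by (smt (verit))
qed

lemma N_dual_at_top:
  assumes "\<eta> > 0"
  shows "filterlim (\<lambda>t. N (dual \<eta> z0 t)) at_top sequentially"
  by (rule filterlim_at_top_mono[OF dual_inner_at_top[OF assms, of z0]]) (simp add: inner_r_le)

text \<open>With bounded gradients and \<open>N z\<close> tending to infinity, steps are eventually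
  short relative to \<open>N z\<close>, so \<open>\<Phi>\<close> no longer decreases; its constant
  lower bound is negligible against \<open>N z\<close>.\<close>

lemma dual_aligned:
  assumes \<eta>: "\<eta> > 0" and G: "\<And>t. norm (dgrad (dual \<eta> z0 t)) \<le> G" and d: "d > 0" "d < 1"
  shows "eventually (\<lambda>t. dual \<eta> z0 t \<bullet> r \<ge> (1 - d) * N (dual \<eta> z0 t)) sequentially"
proof -
  let ?z = "dual \<eta> z0"
  define \<delta> where "\<delta> = d / 2"
  have \<delta>: "\<delta> > 0" using d by (simp add: \<delta>_def)
  obtain Ns \<kappa> where Ns: "Ns > 0" and \<kappa>: "\<kappa> > 0" and N_step:
    "\<And>z \<eta>. Ns \<le> N z \<Longrightarrow> 0 < \<eta> \<Longrightarrow> \<eta> * norm (dgrad z) \<le> \<kappa> * N z \<Longrightarrow>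
      N (z - \<eta> *\<^sub>R dgrad z) - N z \<le> (1 + \<delta>) * (\<eta> * - (dgrad z \<bullet> r))"
    using one_step[OF \<delta>] by blast
  have "eventually (\<lambda>t. N (?z t) \<ge> max Ns (\<eta> * G / \<kappa>)) sequentially"
    using N_dual_at_top[OF \<eta>, of z0] unfolding filterlim_at_top by blast
  then obtain T where T: "\<And>t. t \<ge> T \<Longrightarrow> N (?z t) \<ge> max Ns (\<eta> * G / \<kappa>)"
    by (auto simp: eventually_sequentially)
  define \<Phi> where "\<Phi> t = (1 + \<delta>) * (?z t \<bullet> r) - N (?z t)" for t
  have \<Phi>: "\<Phi> T \<le> \<Phi> t" if "t \<ge> T" for t
    using that
  proof (induction t rule: dec_induct)
    case (step t)
    have "\<eta> * norm (dgrad (?z t)) \<le> \<eta> * G"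
      using \<eta> G by (intro mult_left_mono) auto
    also have "\<dots> \<le> \<kappa> * N (?z t)"
      using T[of t] step \<kappa> by (simp add: field_simps)
    finally have "N (?z (Suc t)) - N (?z t) \<le> (1 + \<delta>) * (\<eta> * - (dgrad (?z t) \<bullet> r))"
      using N_step[of "?z t" \<eta>] T[of t] step \<eta> by simp
    also have "\<dots> = (1 + \<delta>) * (?z (Suc t) \<bullet> r) - (1 + \<delta>) * (?z t \<bullet> r)"
      by (simp add: inner_diff_left algebra_simps)
    finally show ?case using step by (simp add: \<Phi>_def)
  qed simp
  have "eventually (\<lambda>t. N (?z t) \<ge> \<bar>\<Phi> T\<bar> / \<delta>) sequentially"
    using N_dual_at_top[OF \<eta>, of z0] unfolding filterlim_at_top by blast
  then show ?thesis
    using eventually_ge_at_top[of T]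
  proof eventually_elim
    case (elim t)
    have "\<bar>\<Phi> T\<bar> \<le> \<delta> * N (?z t)" using elim(1) \<delta> by (simp add: field_simps)
    then have "(1 + \<delta>) * (?z t \<bullet> r) \<ge> (1 - \<delta>) * N (?z t)"
      using \<Phi>[OF elim(2)] by (simp add: \<Phi>_def algebra_simps)
    moreover have "(1 - \<delta>) * N (?z t) \<ge> ((1 + \<delta>) * (1 - d)) * N (?z t)"
      using d by (intro mult_right_mono pnorm_nonneg) (auto simp: \<delta>_def algebra_simps)
    ultimately have "(1 + \<delta>) * ((1 - d) * N (?z t)) \<le> (1 + \<delta>) * (?z t \<bullet> r)"
      by (simp add: mult.assoc)
    then show ?case using \<delta> by (simp add: mult_le_cancel_left)
  qed
qed

lemma dir_dual_tendsto:
  assumes \<eta>: "\<eta> > 0" and G: "\<And>t. norm (dgrad (dual \<eta> z0 t)) \<le> G"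
  shows "(\<lambda>t. dir (dual \<eta> z0 t)) \<longlonglongrightarrow> r"
proof (rule tendstoI)
  fix e :: real assume "e > 0"
  then obtain d where d: "d > 0" "d < 1"
    "\<And>z. N z > 0 \<Longrightarrow> z \<bullet> r \<ge> (1 - d) * N z \<Longrightarrow> norm (dir z - r) < e"
    using dir_near[OF _ pnorm_reg_direction_le[OF r]] by blast
  have "eventually (\<lambda>t. N (dual \<eta> z0 t) \<ge> 1) sequentially"
    using N_dual_at_top[OF \<eta>, of z0] unfolding filterlim_at_top by blast
  then show "eventually (\<lambda>t. dist (dir (dual \<eta> z0 t)) r < e) sequentially"
    using dual_aligned[OF \<eta> G d(1,2)]
    by eventually_elim (simp add: dist_norm d(3))
qed

theorem pgd_tendsto_reg_direction:
  "\<exists>\<eta>0>0. \<forall>\<eta>. 0 < \<eta> \<and> \<eta> < \<eta>0 \<longrightarrow>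
     (\<lambda>t. (1 / pnorm p (pgd p \<eta> risk w0 t)) *\<^sub>R pgd p \<eta> risk w0 t) \<longlonglongrightarrow> r"
proof -
  obtain G \<eta>0 where "\<eta>0 > 0" and
    "\<And>\<eta> t. 0 < \<eta> \<Longrightarrow> \<eta> < \<eta>0 \<Longrightarrow> norm (dgrad (dual \<eta> (spow_vec (p - 1) w0) t)) \<le> G"
    using dgrad_bounded[of "spow_vec (p - 1) w0"] by blast
  then show ?thesis
    by (intro exI[of _ \<eta>0]) (auto simp: pgd_eq_primal_dual normalized_primal intro!: dir_dual_tendsto)
qed

end

section \<open>From labelled data to signed samples\<close>

theorem theorem3:
  fixes p q C :: real and n :: nat
    and x :: "nat \<Rightarrow> real ^ 'd" and y :: "nat \<Rightarrow> real"
    and l :: "real \<Rightarrow> real" and r :: "real ^ 'd"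
  assumes p_gt1: "p > 1"
    and q_def: "1 / p + 1 / q = 1"
    and n_pos: "n > 0"
    and labels: "\<forall>i<n. y i \<in> {-1, 1}"
    and separable: "\<exists>ws :: real ^ 'd. \<forall>i<n. sgn (ws \<bullet> x i) = y i"
    and bounded: "\<forall>i<n. pnorm q (x i) < C"
    and l_diff: "\<forall>z. l differentiable (at z)"
    and l_decr: "antimono l"
    and l_convex: "convex_on UNIV l"
    and l_nomin: "\<forall>z. \<exists>z'. l z' < l z"
    and l_inf: "bdd_below (range l)" "(INF z. l z) = 0"
    and regdir: "reg_direction p (emp_risk l n x y) r"
  shows "\<forall>w0. \<exists>\<eta>0>0. \<forall>\<eta>. 0 < \<eta> \<and> \<eta> < \<eta>0 \<longrightarrow>
           ((\<lambda>t. (1 / pnorm p (pgd p \<eta> (emp_risk l n x y) w0 t)) *\<^sub>R pgd p \<eta> (emp_risk l n x y) w0 t)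
              \<longlongrightarrow> r) sequentially"
proof -
  obtain ws where ws: "\<And>i. i < n \<Longrightarrow> sgn (ws \<bullet> x i) = y i"
    using separable by blast
  \<comment> \<open>Flipping each sample by its label turns correct classification into positive
    margins; \<open>y i \<noteq> 0\<close> rules out \<open>sgn 0\<close>.\<close>
  define a where "a i = y i *\<^sub>R x i" for i
  have "ws \<bullet> a i > 0" if "i < n" for i
    using ws[OF that] labels[rule_format, OF that]
    by (auto simp: a_def sgn_if mult_less_0_iff zero_less_mult_iff split: if_splits)
  then interpret separable_risk p q n a l ws
    using assms by unfold_locales auto
  have risk: "risk = emp_risk l n x y"
    by (simp add: fun_eq_iff risk_def emp_risk_def a_def)
  interpret regularized_risk p q n a l ws r
    using regdir by unfold_locales (simp add: risk)
  show ?thesis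
    using pgd_tendsto_reg_direction unfolding risk by blast
qed

end
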